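(* Let $q\ge 3$ be a prime power, let $X\subset\mathbb{P}^3(\mathbb{F}_q)$ be an elliptic quadric, and let $\mathcal{Q}'$ be a quadric in $\mathbb{P}^3(\mathbb{F}_q)$ whose defining form is not proportional to that of $X$. Then the number of points of $\mathbb{P}^3(\mathbb{F}_q)$ lying on both $X$ and $\mathcal{Q}'$ satisfies $$\#(X\cap \mathcal{Q}')(\mathbb{F}_q)=2(q+1),\quad\text{or}\quad \#(X\cap \mathcal{Q}')(\mathbb{F}_q)=2q+1,\quad\text{or}\quad \#(X\cap \mathcal{Q}')(\mathbb{F}_q)\le 2q.$$
   Context: A quadric in $\mathbb{P}^3(\mathbb{F}_q)=PG(3,q)$ is the zero set $Z(f)$ of a nonzero form $f$ of degree 2 in $x_0,\dots,x_3$ over $\mathbb{F}_q$. It is non-degenerate if it has rank 4, the rank being the smallest number of indeterminates appearing in $f$ under any linear change of coordinates. An elliptic quadric is a non-degenerate quadric with $q^2+1$ points over $\mathbb{F}_q$ (it contains no line defined over $\mathbb{F}_q$). *)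

theory Defs
  imports "HOL-Analysis.Analysis" "HOL-Library.Poly_Mapping"
begin

text \<open>
  Polynomials with coefficients in \<open>'a\<close> in indeterminates indexed by the finite type \<open>'n\<close>:
  a monomial is its exponent vector \<open>'n \<Rightarrow>\<^sub>0 nat\<close>, and the multiplication of
  \<^theory>\<open>HOL-Library.Poly_Mapping\<close> (convolution) is the multiplication of polynomials.
\<close>

type_synonym ('n, 'a) mpoly = "('n \<Rightarrow>\<^sub>0 nat) \<Rightarrow>\<^sub>0 'a"

definition Const :: "'a::comm_ring_1 \<Rightarrow> ('n, 'a) mpoly" where
  "Const c = Poly_Mapping.single 0 c"

definition Indet :: "'n \<Rightarrow> ('n, 'a::comm_ring_1) mpoly" where
  "Indet i = Poly_Mapping.single (Poly_Mapping.single i 1) 1"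

definition monom_degree :: "('n \<Rightarrow>\<^sub>0 nat) \<Rightarrow> nat" where
  "monom_degree m = (\<Sum>i\<in>Poly_Mapping.keys m. Poly_Mapping.lookup m i)"

text \<open>The zero polynomial counts as a form of every degree.\<close>

definition is_form :: "nat \<Rightarrow> ('n, 'a::comm_ring_1) mpoly \<Rightarrow> bool" where
  "is_form d f \<longleftrightarrow> (\<forall>m\<in>Poly_Mapping.keys f. monom_degree m = d)"

definition indets :: "('n, 'a::comm_ring_1) mpoly \<Rightarrow> 'n set" where
  "indets f = (\<Union>m\<in>Poly_Mapping.keys f. Poly_Mapping.keys m)"

text \<open>
  The value of \<open>f\<close> in the ring \<open>'b\<close>, where coefficients are mapped by \<open>h\<close> and the indeterminate
  \<open>i\<close> is replaced by \<open>s i\<close>. It serves both for the evaluation at a vector and for the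
  substitution of polynomials.
\<close>

definition subst ::
  "('a::comm_ring_1 \<Rightarrow> 'b::comm_ring_1) \<Rightarrow> ('n \<Rightarrow> 'b) \<Rightarrow> ('n, 'a) mpoly \<Rightarrow> 'b" where
  "subst h s f = (\<Sum>m\<in>Poly_Mapping.keys f.
     h (Poly_Mapping.lookup f m) * (\<Prod>i\<in>Poly_Mapping.keys m. s i ^ Poly_Mapping.lookup m i))"

definition eval :: "('n::finite, 'a::comm_ring_1) mpoly \<Rightarrow> 'a ^ 'n \<Rightarrow> 'a" where
  "eval f v = subst (\<lambda>c. c) (\<lambda>i. v $ i) f"

definition change_coords ::
  "'a::comm_ring_1 ^ 'n ^ 'n \<Rightarrow> ('n::finite, 'a) mpoly \<Rightarrow> ('n, 'a) mpoly" where
  "change_coords A f = subst Const (\<lambda>i. \<Sum>j\<in>UNIV. Const (A $ i $ j) * Indet j) f"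

definition form_rank :: "('n::finite, 'a::field) mpoly \<Rightarrow> nat" where
  "form_rank f = (LEAST r. \<exists>A :: 'a ^ 'n ^ 'n.
     invertible A \<and> card (indets (change_coords A f)) = r)"

definition proportional :: "('n, 'a::field) mpoly \<Rightarrow> ('n, 'a) mpoly \<Rightarrow> bool" where
  "proportional f g \<longleftrightarrow> (\<exists>c. c \<noteq> 0 \<and> g = Const c * f)"

definition proj_points :: "('a::field ^ 'n::finite) set set" where
  "proj_points = {P. vec.subspace P \<and> vec.dim P = 1}"

text \<open>For a form, vanishing on all of \<open>P\<close> is vanishing at any one nonzero vector of \<open>P\<close>.\<close>

definition zero_set :: "('n::finite, 'a::field) mpoly \<Rightarrow> ('a ^ 'n) set set" where
  "zero_set f = {P \<in> proj_points. \<forall>v\<in>P. eval f v = 0}"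

text \<open>
  Different forms may have the same zero set over a finite field, so a quadric in
  \<open>PG(3,q)\<close> is represented by its defining form. The type \<open>4\<close> has the elements
  \<open>0, 1, 2, 3\<close>.
\<close>

definition quadric :: "(4, 'a::field) mpoly \<Rightarrow> bool" where
  "quadric f \<longleftrightarrow> is_form 2 f \<and> f \<noteq> 0"

definition nondegenerate :: "(4, 'a::field) mpoly \<Rightarrow> bool" where
  "nondegenerate f \<longleftrightarrow> form_rank f = 4"

definition elliptic_quadric :: "(4, 'a::{field,finite}) mpoly \<Rightarrow> bool" where
  "elliptic_quadric f \<longleftrightarrow>
     quadric f \<and> nondegenerate f \<and> card (zero_set f) = CARD('a) ^ 2 + 1"

end

theory Submission imports Defs begin

text \<open>
  Let \<open>b\<close> be the number of common points. A quadric of \<open>PG(3,q)\<close> that contains no plane has at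
  most \<open>(q + 1)\<^sup>2\<close> points. If no member of the pencil spanned by \<open>f\<close> and \<open>g\<close> contains a plane,
  then counting points over the \<open>q + 1\<close> members, where the common points lie on all of them
  and every other point lies on exactly one, gives
  \<open>(q\<^sup>2 + 1) + q (q + 1)\<^sup>2 \<ge> (q\<^sup>3 + q\<^sup>2 + q + 1) + q b\<close>, hence \<open>b \<le> 2q\<close>. Otherwise some member is a
  product of two linear forms, and a plane meets the elliptic quadric in at most \<open>q + 1\<close>
  points, hence \<open>b \<le> 2 (q + 1)\<close>. All counting is done with vectors: a cone with \<open>n\<close> projective
  points consists of \<open>1 + (q - 1) n\<close> vectors.
\<close>

subsection \<open>Quadratic forms on a finite vector space\<close>

definition linear_functional :: "('a::field ^ 'n \<Rightarrow> 'a) \<Rightarrow> bool" where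
  "linear_functional l \<longleftrightarrow>
     (\<forall>u v. l (u + v) = l u + l v) \<and> (\<forall>c v. l (c *s v) = c * l v)"

text \<open>The usual associated bilinear form, taken without the factor 1/2 so that characteristic
  2 is covered as well.\<close>

definition polar :: "('a::field ^ 'n \<Rightarrow> 'a) \<Rightarrow> 'a ^ 'n \<Rightarrow> 'a ^ 'n \<Rightarrow> 'a" where
  "polar F u v = F (u + v) - F u - F v"

text \<open>Homogeneity is demanded separately because in characteristic 2 the polar form does not
  determine \<open>F\<close>. Linearity in one argument suffices, since \<open>polar F\<close> is
  symmetric.\<close>

definition quadratic_form :: "('a::field ^ 'n \<Rightarrow> 'a) \<Rightarrow> bool" where
  "quadratic_form F \<longleftrightarrow>
     (\<forall>c v. F (c *s v) = c\<^sup>2 * F v) \<and> (\<forall>u. linear_functional (polar F u))"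

lemma linear_functional_add: "linear_functional l \<Longrightarrow> l (u + v) = l u + l v"
  and linear_functional_scale: "linear_functional l \<Longrightarrow> l (c *s v) = c * l v"
  by (auto simp: linear_functional_def)

lemma linear_functional_zero: "linear_functional l \<Longrightarrow> l 0 = 0"
  using linear_functional_scale[of l 0 0] by simp

lemma linear_functional_diff: "linear_functional l \<Longrightarrow> l (u - v) = l u - l v"
  by (metis add_diff_cancel_right' diff_add_cancel linear_functional_add)

lemma polar_commute: "polar F u v = polar F v u"
  by (simp add: polar_def add.commute)

lemma quadratic_form_scale: "quadratic_form F \<Longrightarrow> F (c *s v) = c\<^sup>2 * F v"
  and linear_functional_polar: "quadratic_form F \<Longrightarrow> linear_functional (polar F u)"
  by (auto simp: quadratic_form_def)

lemma quadratic_form_add: "F (u + v) = F u + F v + polar F u v"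
  by (simp add: polar_def)

lemma quadratic_form_zero: "quadratic_form F \<Longrightarrow> F 0 = 0"
  using quadratic_form_scale[of F 0 0] by simp

lemma quadratic_form_add_scale:
  "quadratic_form F \<Longrightarrow> F (u + c *s v) = F u + c\<^sup>2 * F v + c * polar F u v"
  by (simp add: quadratic_form_add[of F] quadratic_form_scale
      linear_functional_scale[OF linear_functional_polar])

lemma polar_self: "quadratic_form F \<Longrightarrow> polar F v v = 2 * F v"
  using quadratic_form_scale[of F 2 v] vec.scale_left_distrib[of 1 1 v]
  by (simp add: polar_def)

lemma polar_singular_self: "quadratic_form F \<Longrightarrow> F v = 0 \<Longrightarrow> polar F v v = 0"
  by (simp add: polar_self)

section \<open>Counting singular vectors in subspaces\<close>

lemma subspace_linear_functional_kernel:
  assumes "vec.subspace W" "linear_functional l"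
  shows "vec.subspace {w \<in> W. l w = 0}"
  using assms
  by (auto simp: vec.subspace_def linear_functional_add linear_functional_scale
      linear_functional_zero)

text \<open>The translates of the kernel by the multiples of \<open>e\<close> partition
  \<open>W\<close>.\<close>

lemma card_linear_functional_kernel:
  fixes l :: "'a::{field,finite} ^ 'n::finite \<Rightarrow> 'a"
  assumes W: "vec.subspace W" and l: "linear_functional l" and e: "e \<in> W" "l e \<noteq> 0"
  shows "card W = CARD('a) * card {w \<in> W. l w = 0}"
proof -
  have "bij_betw (\<lambda>(c, w). w + c *s e) (UNIV \<times> {w \<in> W. l w = 0}) W"
    by (rule bij_betw_byWitness[where f' = "\<lambda>w. (l w / l e, w - (l w / l e) *s e)"])
       (use W e in \<open>auto simp: l linear_functional_add linear_functional_diff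
          linear_functional_scale vec.subspace_add vec.subspace_diff vec.subspace_scale\<close>)
  from bij_betw_same_card[OF this] show ?thesis
    by (simp add: card_cartesian_product)
qed

text \<open>For singular \<open>p\<close> with \<open>polar F p w \<noteq> 0\<close>, the affine line \<open>w + span {p}\<close>
  carries exactly one singular vector.\<close>

lemma card_singular_not_orthogonal:
  fixes F :: "'a::{field,finite} ^ 'n::finite \<Rightarrow> 'a"
  assumes F: "quadratic_form F" and W: "vec.subspace W" and p: "p \<in> W" "F p = 0"
  shows "CARD('a) * card {w \<in> W. F w = 0 \<and> polar F p w \<noteq> 0} = card {w \<in> W. polar F p w \<noteq> 0}"
proof -
  note L = linear_functional_polar[OF F]
  have pp: "polar F p p = 0" by (rule polar_singular_self[OF F p(2)])
  have B: "polar F p (w + c *s p) = polar F p w" for w c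
    by (simp add: linear_functional_add[OF L] linear_functional_scale[OF L] pp)
  have B': "polar F p (w - c *s p) = polar F p w" for w c
    by (simp add: linear_functional_diff[OF L] linear_functional_scale[OF L] pp)
  have Q: "F (w + c *s p) = F w + c * polar F p w" for w c
    by (simp add: quadratic_form_add_scale[OF F] p polar_commute)
  have Q': "F (w - c *s p) = F w - c * polar F p w" for w c
    using Q[of w "- c"] by simp
  have "bij_betw (\<lambda>(c, w). w + c *s p) (UNIV \<times> {w \<in> W. F w = 0 \<and> polar F p w \<noteq> 0})
          {w \<in> W. polar F p w \<noteq> 0}"
    \<comment> \<open>As \<open>p\<close> is singular, \<open>F\<close> is affine along the line,
      \<open>F (w - c *s p) = F w - c * polar F p w\<close>; the witness is its unique root
      \<open>c\<close>.\<close>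
    by (rule bij_betw_byWitness[where f' = "\<lambda>w. (F w / polar F p w,
            w - (F w / polar F p w) *s p)"])
       (use W p in \<open>auto simp: B B' Q Q' vec.subspace_add vec.subspace_diff vec.subspace_scale\<close>)
  from bij_betw_same_card[OF this] show ?thesis
    by (simp add: card_cartesian_product)
qed

text \<open>With q the field size, q^(n+2) - q^(n+1) vectors of \<open>W\<close> are not orthogonal
  to \<open>p\<close>, and one in q of them is singular. This reduces the count to the tangent
  hyperplane at \<open>p\<close>. Sums replace differences to avoid truncated subtraction.\<close>

lemma card_singular:
  fixes F :: "'a::{field,finite} ^ 'n::finite \<Rightarrow> 'a"
  assumes F: "quadratic_form F" and W: "vec.subspace W" and p: "p \<in> W" "F p = 0"
    and w: "w \<in> W" "polar F p w \<noteq> 0" and card: "card W = CARD('a) ^ (n + 2)"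
  shows "card {w \<in> W. polar F p w = 0} = CARD('a) ^ (n + 1)"
    and "card {w \<in> W. F w = 0} + CARD('a) ^ n =
           CARD('a) ^ (n + 1) + card {w \<in> W. F w = 0 \<and> polar F p w = 0}"
proof -
  show k: "card {w \<in> W. polar F p w = 0} = CARD('a) ^ (n + 1)"
    using card_linear_functional_kernel[OF W linear_functional_polar[OF F] w] card by simp
  have "card W = card {w \<in> W. polar F p w \<noteq> 0} + card {w \<in> W. polar F p w = 0}"
    by (subst card_Un_disjoint[symmetric]) (auto intro: arg_cong[where f = card])
  then have "CARD('a) * (card {w \<in> W. F w = 0 \<and> polar F p w \<noteq> 0} + CARD('a) ^ n) =
      CARD('a) * CARD('a) ^ (n + 1)"
    using card_singular_not_orthogonal[OF F W p] k card by (simp add: algebra_simps)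
  then have "card {w \<in> W. F w = 0 \<and> polar F p w \<noteq> 0} + CARD('a) ^ n = CARD('a) ^ (n + 1)"
    by (rule mult_left_cancel[THEN iffD1, rotated]) simp
  moreover have "card {w \<in> W. F w = 0} = card {w \<in> W. F w = 0 \<and> polar F p w \<noteq> 0}
      + card {w \<in> W. F w = 0 \<and> polar F p w = 0}"
    by (subst card_Un_disjoint[symmetric]) (auto intro: arg_cong[where f = card])
  ultimately show "card {w \<in> W. F w = 0} + CARD('a) ^ n =
      CARD('a) ^ (n + 1) + card {w \<in> W. F w = 0 \<and> polar F p w = 0}"
    by simp
qed

text \<open>Complements \<open>card_singular\<close>: here all singular vectors of \<open>W\<close>
  lie in the radical. Then \<open>F (u + c *s v) = c\<^sup>2 * F v\<close> for singular
  \<open>u\<close>, so translates of the singular set by distinct multiples of \<open>v\<close> are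
  disjoint.\<close>

lemma card_singular_radical:
  fixes F :: "'a::{field,finite} ^ 'n::finite \<Rightarrow> 'a"
  assumes F: "quadratic_form F" and W: "vec.subspace W" and v: "v \<in> W" "F v \<noteq> 0"
    and rad: "\<And>p w. p \<in> W \<Longrightarrow> F p = 0 \<Longrightarrow> w \<in> W \<Longrightarrow> polar F p w = 0"
  shows "CARD('a) * card {w \<in> W. F w = 0} \<le> card W"
proof -
  have "inj_on (\<lambda>(c, w). w + c *s v) (UNIV \<times> {w \<in> W. F w = 0})"
  proof (clarsimp simp: inj_on_def)
    fix c w d u
    assume *: "w \<in> W" "F w = 0" "u \<in> W" "F u = 0" "w + c *s v = u + d *s v"
    then have "w = u + (d - c) *s v"
      by (simp add: vector_ssub_ldistrib algebra_simps)
    with *(2) have "F (u + (d - c) *s v) = 0" by (simp only:)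
    moreover have "polar F u v = 0" using rad * v by blast
    ultimately have "(d - c)\<^sup>2 * F v = 0"
      using *(4) by (simp only: quadratic_form_add_scale[OF F]) simp
    then show "c = d \<and> w = u" using v * by simp
  qed
  moreover have "(\<lambda>(c, w). w + c *s v) ` (UNIV \<times> {w \<in> W. F w = 0}) \<subseteq> W"
    using W v by (auto intro: vec.subspace_add vec.subspace_scale)
  ultimately have "card ((UNIV :: 'a set) \<times> {w \<in> W. F w = 0}) \<le> card W"
    by (intro card_inj_on_le) auto
  then show ?thesis by (simp add: card_cartesian_product)
qed

text \<open>For a plane not contained in the quadric this is the bound of 2q + 1 projective points,
  as 1 + (q - 1)(2q + 1) = 2q^2 - q.\<close>

lemma card_singular_hyperplane_le:
  fixes F :: "'a::{field,finite} ^ 'n::finite \<Rightarrow> 'a"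
  assumes F: "quadratic_form F" and W: "vec.subspace W" and v: "v \<in> W" "F v \<noteq> 0"
    and card: "card W = CARD('a) ^ 3"
  shows "card {w \<in> W. F w = 0} + CARD('a) \<le> 2 * CARD('a)\<^sup>2"
proof (cases "\<exists>p\<in>W. F p = 0 \<and> (\<exists>w\<in>W. polar F p w \<noteq> 0)")
  case True
  then obtain p w where p: "p \<in> W" "F p = 0" and w: "w \<in> W" "polar F p w \<noteq> 0" by blast
  have "card {w \<in> W. F w = 0 \<and> polar F p w = 0} \<le> card {w \<in> W. polar F p w = 0}"
    by (rule card_mono) auto
  with card_singular[OF F W p w, of 1] card show ?thesis
    by (simp add: numeral_eq_Suc)
next
  case False
  then have "CARD('a) * card {w \<in> W. F w = 0} \<le> CARD('a) * CARD('a)\<^sup>2"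
    using card_singular_radical[OF F W v] card by (auto simp: numeral_eq_Suc)
  then have "card {w \<in> W. F w = 0} \<le> CARD('a)\<^sup>2" by simp
  moreover have "CARD('a) \<le> CARD('a)\<^sup>2" by (simp add: power2_eq_square)
  ultimately show ?thesis by simp
qed

text \<open>In projective terms: a quadric of \<open>PG(3,q)\<close> containing no plane has at most
  \<open>(q + 1)\<^sup>2\<close> points.\<close>

lemma card_singular_le_or_hyperplane:
  fixes F :: "'a::{field,finite} ^ 4 \<Rightarrow> 'a"
  assumes F: "quadratic_form F" and v: "F v \<noteq> 0"
  obtains "card {w. F w = 0} + CARD('a) \<le> CARD('a) ^ 3 + CARD('a)\<^sup>2"
  | l e where "linear_functional l" "l e \<noteq> 0" "\<And>w. l w = 0 \<Longrightarrow> F w = 0"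
proof (cases "\<exists>p w. F p = 0 \<and> polar F p w \<noteq> 0")
  case True
  then obtain p w where p: "F p = 0" and w: "polar F p w \<noteq> 0" by blast
  let ?W = "{w. polar F p w = 0}"
  note L = linear_functional_polar[OF F, of p]
  have W: "vec.subspace ?W"
    using subspace_linear_functional_kernel[OF vec.subspace_UNIV L] by simp
  have *: "card ?W = CARD('a) ^ 3"
    "card {w. F w = 0} + CARD('a)\<^sup>2 = CARD('a) ^ 3 + card {w. F w = 0 \<and> polar F p w = 0}"
    using card_singular[OF F vec.subspace_UNIV, of p w 2] p w by (simp_all add: numeral_eq_Suc)
  show thesis
  proof (cases "\<forall>w\<in>?W. F w = 0")
    case True
    with that(2)[OF L w] show thesis by blast
  next
    \<comment> \<open>The plane bound leaves at most 2q^2 - q singular vectors in the tangent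
      hyperplane, so the total is at most q^3 + q^2 - q = 1 + (q - 1)(q + 1)^2.\<close>
    case False
    with card_singular_hyperplane_le[OF F W _ _ *(1)]
    have "card {w. F w = 0 \<and> polar F p w = 0} + CARD('a) \<le> 2 * CARD('a)\<^sup>2"
      by (auto simp: conj_commute)
    with *(2) show thesis by (intro that(1)) simp
  qed
next
  case False
  have "CARD('a) * card {w. F w = 0} \<le> CARD('a) * CARD('a) ^ 3"
    using card_singular_radical[OF F vec.subspace_UNIV _ v] False by (auto simp: numeral_eq_Suc)
  then have "card {w. F w = 0} \<le> CARD('a) ^ 3" by simp
  moreover have "CARD('a) \<le> CARD('a)\<^sup>2" by (simp add: power2_eq_square)
  ultimately show thesis by (intro that(1)) simp
qed

text \<open>Normalise \<open>e\<close> to \<open>d\<close> with \<open>l d = 1\<close>. The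
  projection of \<open>w\<close> along \<open>d\<close> lies in the kernel of \<open>l\<close>, and
  expanding \<open>F\<close> there exhibits the factor \<open>l w\<close>.\<close>

lemma quadratic_form_factor:
  fixes F :: "'a::field ^ 'n::finite \<Rightarrow> 'a"
  assumes F: "quadratic_form F" and l: "linear_functional l" "l e \<noteq> 0"
    and vanish: "\<And>w. l w = 0 \<Longrightarrow> F w = 0"
  obtains m where "linear_functional m" "\<And>w. F w = l w * m w"
proof
  define d where "d = (1 / l e) *s e"
  have d: "l d = 1" using l by (simp add: d_def linear_functional_scale)
  note L = linear_functional_polar[OF F]
  define m where "m = (\<lambda>w. polar F d w - l w * F d)"
  show "linear_functional m"
    using l(1) L[of d] by (simp add: m_def linear_functional_def algebra_simps)
  show "F w = l w * m w" for w
  proof -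
    have "F (w + (- l w) *s d) = 0"
      by (rule vanish) (simp only: linear_functional_add[OF l(1)] linear_functional_scale[OF l(1)] d, simp)
    then have "F w + (l w)\<^sup>2 * F d - l w * polar F w d = 0"
      by (simp only: quadratic_form_add_scale[OF F]) simp
    then show ?thesis
      by (simp add: m_def polar_commute[of F d] algebra_simps power2_eq_square)
  qed
qed

text \<open>The assumption \<open>card\<close> encodes q^2 + 1 projective points, the conclusion at
  most q + 1 points in a plane. The proof compares the plane with the tangent plane at one of its
  singular points.\<close>

lemma card_singular_hyperplane_elliptic:
  fixes F :: "'a::{field,finite} ^ 4 \<Rightarrow> 'a"
  assumes F: "quadratic_form F"
    and nondeg: "\<And>p. p \<noteq> 0 \<Longrightarrow> F p = 0 \<Longrightarrow> \<exists>w. polar F p w \<noteq> 0"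
    and card: "card {w. F w = 0} + CARD('a)\<^sup>2 = CARD('a) ^ 3 + CARD('a)"
    and l: "linear_functional l" "l e \<noteq> 0"
  shows "card {w. F w = 0 \<and> l w = 0} \<le> CARD('a)\<^sup>2"
proof -
  let ?W = "{w. l w = 0}"
  have W: "vec.subspace ?W"
    using subspace_linear_functional_kernel[OF vec.subspace_UNIV l(1)] by simp
  have cW: "card ?W = CARD('a) ^ 3"
    using card_linear_functional_kernel[OF vec.subspace_UNIV l(1) _ l(2)]
    by (simp add: numeral_eq_Suc)
  have q: "CARD('a) \<le> CARD('a)\<^sup>2" by (simp add: power2_eq_square)
  show ?thesis
  proof (cases "\<exists>p. p \<noteq> 0 \<and> F p = 0 \<and> l p = 0")
    case False
    then have "{w. F w = 0 \<and> l w = 0} \<subseteq> {0}" by blast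
    then have "card {w. F w = 0 \<and> l w = 0} \<le> card {0 :: 'a ^ 4}" by (intro card_mono) auto
    also have "\<dots> \<le> CARD('a)\<^sup>2" by (simp add: Suc_leI)
    finally show ?thesis .
  next
    case True
    then obtain p where p: "p \<noteq> 0" "F p = 0" "l p = 0" by blast
    then obtain w where w: "polar F p w \<noteq> 0" using nondeg by blast
    \<comment> \<open>The point count forces the tangent hyperplane at \<open>p\<close> to contain
      only the q multiples of \<open>p\<close> as singular vectors.\<close>
    have S: "card {w. F w = 0 \<and> polar F p w = 0} = CARD('a)"
      using card_singular(2)[OF F vec.subspace_UNIV, of p w 2] p w card
      by (simp add: numeral_eq_Suc)
    show ?thesis
    \<comment> \<open>Either \<open>p\<close> is outside the radical of the section and the count
      with \<open>n = 1\<close> applies, or the plane lies inside the tangent hyperplane at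
      \<open>p\<close>.\<close>
    proof (cases "\<exists>u. l u = 0 \<and> polar F p u \<noteq> 0")
      case True
      then obtain u where u: "l u = 0" "polar F p u \<noteq> 0" by blast
      have "card {w \<in> ?W. F w = 0 \<and> polar F p w = 0} \<le> CARD('a)"
        unfolding S[symmetric] by (rule card_mono) auto
      with card_singular(2)[OF F W _ p(2), of u 1] p u cW show ?thesis
        by (simp add: numeral_eq_Suc conj_commute)
    next
      case False
      then have "card {w. F w = 0 \<and> l w = 0} \<le> CARD('a)"
        unfolding S[symmetric] by (intro card_mono) auto
      with q show ?thesis by simp
    qed
  qed
qed

section \<open>Pencils of quadratic forms\<close>

lemma quadratic_form_add_scaled:
  assumes F: "quadratic_form F" and G: "quadratic_form G"
  shows "quadratic_form (\<lambda>v. G v + c * F v)"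
proof -
  have "polar (\<lambda>v. G v + c * F v) = (\<lambda>u v. polar G u v + c * polar F u v)"
    by (simp add: fun_eq_iff polar_def algebra_simps)
  then show ?thesis
    using assms unfolding quadratic_form_def linear_functional_def by (simp add: algebra_simps)
qed

text \<open>Double counting of incidences between vectors and the q + 1 members, \<open>F\<close>
  being the member at infinity. For fixed \<open>v\<close> the condition is linear in
  \<open>c\<close>: a common zero lies on all members, any other vector on exactly one.\<close>

lemma pencil_count:
  fixes F G :: "'v::finite \<Rightarrow> 'a::{field,finite}"
  shows "card {v. F v = 0} + (\<Sum>c\<in>UNIV. card {v. G v + c * F v = 0}) =
           CARD('v) + CARD('a) * card {v. F v = 0 \<and> G v = 0}"
proof -
  have one: "card {c. G v + c * F v = 0} =
      (if F v \<noteq> 0 then 1 else if G v = 0 then CARD('a) else 0)" for v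
  proof -
    have "{c. G v + c * F v = 0} = {- G v / F v}" if "F v \<noteq> 0"
      using that by (auto simp: field_simps eq_neg_iff_add_eq_0)
    then show ?thesis by (cases "F v = 0") auto
  qed
  have "(\<Sum>c\<in>UNIV. card {v. G v + c * F v = 0}) = (\<Sum>v\<in>UNIV. card {c. G v + c * F v = 0})"
    using sum.swap[of "\<lambda>c v. if G v + c * F v = 0 then 1 else 0 :: nat" UNIV UNIV]
    by (simp add: sum.If_cases)
  also have "\<dots> = (\<Sum>v\<in>UNIV. (if F v \<noteq> 0 then 1 else 0) +
      CARD('a) * (if F v = 0 \<and> G v = 0 then 1 else 0))"
    by (rule sum.cong) (auto simp: one)
  also have "\<dots> = card {v. F v \<noteq> 0} + CARD('a) * card {v. F v = 0 \<and> G v = 0}"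
    by (simp add: sum.distrib sum.If_cases flip: sum_distrib_left)
  finally have *: "(\<Sum>c\<in>UNIV. card {v. G v + c * F v = 0}) = \<dots>" .
  have "card {v. F v = 0} + card {v. F v \<noteq> 0} = CARD('v)"
    by (subst card_Un_disjoint[symmetric]) (auto intro: arg_cong[where f = card])
  with * show ?thesis by simp
qed

text \<open>The common zeros are the union of two plane sections of at most q^2 vectors each, which
  share the zero vector.\<close>

lemma card_common_zeros_factored:
  fixes F :: "'a::{field,finite} ^ 4 \<Rightarrow> 'a"
  assumes F: "quadratic_form F"
    and nondeg: "\<And>p. p \<noteq> 0 \<Longrightarrow> F p = 0 \<Longrightarrow> \<exists>w. polar F p w \<noteq> 0"
    and card: "card {w. F w = 0} + CARD('a)\<^sup>2 = CARD('a) ^ 3 + CARD('a)"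
    and l: "linear_functional l" and m: "linear_functional m" and v: "l v * m v \<noteq> 0"
  shows "card {w. F w = 0 \<and> l w * m w = 0} + 1 \<le> 2 * CARD('a)\<^sup>2"
proof -
  let ?L = "{w. F w = 0 \<and> l w = 0}" and ?M = "{w. F w = 0 \<and> m w = 0}"
  have "card {0 :: 'a ^ 4} \<le> card (?L \<inter> ?M)"
    by (rule card_mono) (auto simp: linear_functional_zero l m quadratic_form_zero F)
  moreover have "card ?L + card ?M = card (?L \<union> ?M) + card (?L \<inter> ?M)"
    by (rule card_Un_Int) auto
  moreover have "?L \<union> ?M = {w. F w = 0 \<and> l w * m w = 0}" by auto
  moreover have "card ?L \<le> CARD('a)\<^sup>2" "card ?M \<le> CARD('a)\<^sup>2"
    using v by (auto intro!: card_singular_hyperplane_elliptic[OF F nondeg card] l m)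
  ultimately show ?thesis by simp
qed

lemma card_common_zeros:
  fixes F G :: "'a::{field,finite} ^ 4 \<Rightarrow> 'a"
  assumes F: "quadratic_form F"
    and nondeg: "\<And>p. p \<noteq> 0 \<Longrightarrow> F p = 0 \<Longrightarrow> \<exists>w. polar F p w \<noteq> 0"
    and card: "card {w. F w = 0} + CARD('a)\<^sup>2 = CARD('a) ^ 3 + CARD('a)"
    and G: "quadratic_form G" and indep: "\<And>c. \<exists>v. G v + c * F v \<noteq> 0"
  shows "card {w. F w = 0 \<and> G w = 0} + 1 \<le> 2 * CARD('a)\<^sup>2"
\<comment> \<open>Only the members \<open>G + c * F\<close> are split on; the member
  \<open>F\<close> enters the pencil count with its exact size.\<close>
proof (cases "\<exists>c l e. linear_functional l \<and> l e \<noteq> 0 \<and> (\<forall>w. l w = 0 \<longrightarrow> G w + c * F w = 0)")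
  case True
  then obtain c l e where l: "linear_functional l" "l e \<noteq> 0"
    and van: "\<And>w. l w = 0 \<Longrightarrow> G w + c * F w = 0" by blast
  obtain m where m: "linear_functional m" "\<And>w. G w + c * F w = l w * m w"
    using quadratic_form_factor[OF quadratic_form_add_scaled[OF F G] l van] by blast
  obtain v where "l v * m v \<noteq> 0" using indep[of c] m(2) by auto
  with card_common_zeros_factored[OF F nondeg card l(1) m(1)]
  have "card {w. F w = 0 \<and> l w * m w = 0} + 1 \<le> 2 * CARD('a)\<^sup>2" by blast
  moreover have "{w. F w = 0 \<and> l w * m w = 0} = {w. F w = 0 \<and> G w = 0}"
    by (auto simp flip: m(2))
  ultimately show ?thesis by simp
next
  case False
  let ?q = "CARD('a)" and ?b = "card {w. F w = 0 \<and> G w = 0}"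
  have "card {v. G v + c * F v = 0} + ?q \<le> ?q ^ 3 + ?q\<^sup>2" for c
  proof -
    obtain v where "G v + c * F v \<noteq> 0" using indep by blast
    then show ?thesis
      by (rule card_singular_le_or_hyperplane[OF quadratic_form_add_scaled[OF F G]])
         (use False in blast)+
  qed
  then have "(\<Sum>c\<in>(UNIV :: 'a set). card {v. G v + c * F v = 0} + ?q) \<le> ?q * (?q ^ 3 + ?q\<^sup>2)"
    using sum_bounded_above[of "UNIV :: 'a set" "\<lambda>c. card {v. G v + c * F v = 0} + ?q"] by simp
  then have "(\<Sum>c\<in>(UNIV :: 'a set). card {v. G v + c * F v = 0}) + ?q\<^sup>2 \<le> ?q ^ 4 + ?q ^ 3"
    by (simp add: sum.distrib algebra_simps numeral_eq_Suc)
  with pencil_count[of F G] card have "?q * ?b + 2 * ?q\<^sup>2 \<le> 2 * ?q ^ 3 + ?q"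
    by simp
  then have "?q * (?b + 2 * ?q) \<le> ?q * (2 * ?q\<^sup>2 + 1)"
    by (simp add: algebra_simps numeral_eq_Suc)
  \<comment> \<open>In this case there are at most 2q common projective points, since 1 + (q - 1) 2q
    = 2q^2 - 2q + 1; the bound is then weakened to that of the reducible case.\<close>
  then have "?b + 2 * ?q \<le> 2 * ?q\<^sup>2 + 1" by (simp del: mult_Suc_right)
  moreover have "1 \<le> ?q" by (simp add: Suc_leI)
  ultimately show ?thesis by linarith
qed

subsection \<open>Polynomials of degree two\<close>

text \<open>\<open>i = j\<close> is allowed, so squares and mixed terms are treated uniformly;
  \<open>monom2 c i j\<close> and \<open>monom2 c j i\<close> coincide.\<close>

definition monom2 :: "'a::comm_ring_1 \<Rightarrow> 'n \<Rightarrow> 'n \<Rightarrow> ('n, 'a) mpoly" where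
  "monom2 c i j =
     Poly_Mapping.single (Poly_Mapping.single i 1 + Poly_Mapping.single j 1) c"

lemma monom_degree_superset:
  assumes "finite A" "Poly_Mapping.keys m \<subseteq> A"
  shows "monom_degree m = (\<Sum>i\<in>A. Poly_Mapping.lookup m i)"
  unfolding monom_degree_def using assms
  by (intro sum.mono_neutral_left) (auto simp: in_keys_iff)

lemma monom_degree_add: "monom_degree (m + n) = monom_degree m + monom_degree n"
proof -
  let ?A = "Poly_Mapping.keys m \<union> Poly_Mapping.keys n"
  have "Poly_Mapping.keys (m + n) \<subseteq> ?A" by (rule keys_add)
  then show ?thesis
    by (simp add: monom_degree_superset[of ?A] lookup_add sum.distrib)
qed

lemma monom_degree_single: "monom_degree (Poly_Mapping.single i k) = k"
  by (simp add: monom_degree_def)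

lemma monom_degree_zero_iff: "monom_degree m = 0 \<longleftrightarrow> m = 0"
  by (auto simp: monom_degree_def in_keys_iff intro: poly_mapping_eqI)

lemma monom_degree_SucE:
  assumes "monom_degree m = Suc d"
  obtains i m' where "m = Poly_Mapping.single i 1 + m'" "monom_degree m' = d"
proof -
  from assms have "m \<noteq> 0" using monom_degree_zero_iff[of m] by auto
  then obtain i where i: "Poly_Mapping.lookup m i \<noteq> 0"
    by (metis lookup_zero poly_mapping_eqI)
  define m' where "m' = m - Poly_Mapping.single i 1"
  have m: "m = Poly_Mapping.single i 1 + m'"
    using i by (intro poly_mapping_eqI)
      (auto simp: m'_def lookup_add lookup_minus lookup_single when_def)
  with assms have "monom_degree m' = d" by (simp add: monom_degree_add monom_degree_single)
  with m that show thesis by blast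
qed

lemma monom_degree_2E:
  assumes "monom_degree m = 2"
  obtains i j where "m = Poly_Mapping.single i 1 + Poly_Mapping.single j 1"
proof -
  from assms have "monom_degree m = Suc 1" by simp
  then obtain i n where n: "m = Poly_Mapping.single i 1 + n" "monom_degree n = Suc 0"
    by (auto elim: monom_degree_SucE)
  from n(2) obtain j k where "n = Poly_Mapping.single j 1 + k" "monom_degree k = 0"
    by (rule monom_degree_SucE)
  with n that show thesis by (simp add: monom_degree_zero_iff)
qed

lemma is_form_zero: "is_form d 0"
  by (simp add: is_form_def)

lemma is_form_add: "is_form d f \<Longrightarrow> is_form d g \<Longrightarrow> is_form d (f + g)"
  using keys_add[of f g] by (auto simp: is_form_def)

lemma is_form_sum: "(\<And>x. x \<in> A \<Longrightarrow> is_form d (f x)) \<Longrightarrow> is_form d (sum f A)"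
  by (induction A rule: infinite_finite_induct) (auto simp: is_form_zero is_form_add)

lemma is_form_monom2: "is_form 2 (monom2 c i j)"
  by (auto simp: is_form_def monom2_def monom_degree_add monom_degree_single)

lemma poly_mapping_sum_single:
  "f = (\<Sum>m\<in>Poly_Mapping.keys f. Poly_Mapping.single m (Poly_Mapping.lookup f m))"
  by (rule poly_mapping_eqI)
     (simp add: lookup_sum lookup_single when_def in_keys_iff)

text \<open>A form of degree 2 is the sum of its terms, each of the shape
  \<open>monom2 c i j\<close>. Additive facts about such forms thereby reduce to one
  monomial.\<close>

lemma quadratic_induct [consumes 1, case_names zero monom add]:
  assumes "is_form 2 f"
    and zero: "P 0" and monom: "\<And>c i j. P (monom2 c i j)"
    and add: "\<And>f g. P f \<Longrightarrow> P g \<Longrightarrow> P (f + g)"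
  shows "P f"
proof -
  have "P (\<Sum>m\<in>A. Poly_Mapping.single m (Poly_Mapping.lookup f m))"
    if "finite A" "A \<subseteq> Poly_Mapping.keys f" for A
    using that
  proof (induction A)
    case (insert m A)
    then have "monom_degree m = 2" using assms(1) by (auto simp: is_form_def)
    then obtain i j where "m = Poly_Mapping.single i 1 + Poly_Mapping.single j 1"
      by (rule monom_degree_2E)
    then have "P (Poly_Mapping.single m (Poly_Mapping.lookup f m))"
      using monom[of _ i j] by (simp add: monom2_def)
    with insert add show ?case by simp
  qed (simp add: zero)
  from this[of "Poly_Mapping.keys f"] show ?thesis
    by (simp flip: poly_mapping_sum_single)
qed

section \<open>Substitution and evaluation\<close>

lemma subst_superset:
  assumes "finite A" "Poly_Mapping.keys f \<subseteq> A" "h 0 = 0"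
  shows "subst h s f = (\<Sum>m\<in>A. h (Poly_Mapping.lookup f m) *
           (\<Prod>i\<in>Poly_Mapping.keys m. s i ^ Poly_Mapping.lookup m i))"
  unfolding subst_def using assms
  by (intro sum.mono_neutral_left) (auto simp: in_keys_iff)

lemma subst_add:
  assumes "h 0 = 0" "\<And>a b. h (a + b) = h a + h b"
  shows "subst h s (f + g) = subst h s f + subst h s g"
proof -
  let ?A = "Poly_Mapping.keys f \<union> Poly_Mapping.keys g"
  have "Poly_Mapping.keys (f + g) \<subseteq> ?A" by (rule keys_add)
  then show ?thesis
    by (simp add: subst_superset[of ?A, where h = h] assms lookup_add algebra_simps sum.distrib)
qed

lemma subst_zero: "subst h s 0 = 0"
  by (simp add: subst_def)

lemma subst_monom2:
  assumes "h 0 = 0"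
  shows "subst h s (monom2 c i j) = h c * s i * s j"
proof -
  have "Poly_Mapping.keys (Poly_Mapping.single i 1 + Poly_Mapping.single j 1 :: _ \<Rightarrow>\<^sub>0 nat)
      = {i, j}"
    by (auto simp: in_keys_iff lookup_add lookup_single when_def split: if_splits)
  then show ?thesis
    using assms
    by (cases "i = j")
       (auto simp: subst_def monom2_def lookup_add lookup_single power2_eq_square
         mult.assoc simp flip: one_add_one)
qed

lemma eval_add: "eval (f + g) v = eval f v + eval g v"
  by (simp add: eval_def subst_add)

lemma eval_zero: "eval 0 v = 0"
  by (simp add: eval_def subst_zero)

lemma eval_sum: "eval (sum f A) v = (\<Sum>x\<in>A. eval (f x) v)"
  by (induction A rule: infinite_finite_induct) (auto simp: eval_zero eval_add)

lemma eval_monom2: "eval (monom2 c i j) v = c * v $ i * v $ j"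
  by (simp add: eval_def subst_monom2)

lemma Const_zero: "Const 0 = 0" and Const_add: "Const (a + b) = Const a + Const b"
  by (simp_all add: Const_def single_add)

lemma Const_monom2: "Const a * monom2 c i j = monom2 (a * c) i j"
  by (simp add: Const_def monom2_def mult_single)

lemma is_form_Const_mult: "is_form 2 f \<Longrightarrow> is_form 2 (Const c * f)"
  by (induction rule: quadratic_induct)
     (auto simp: is_form_zero Const_monom2 is_form_monom2 distrib_left is_form_add)

lemma eval_Const_mult: "is_form 2 f \<Longrightarrow> eval (Const c * f) v = c * eval f v"
  by (induction rule: quadratic_induct)
     (auto simp: eval_zero Const_monom2 eval_monom2 distrib_left eval_add)

lemma quadratic_form_eval: "is_form 2 f \<Longrightarrow> quadratic_form (eval f)"
proof (induction rule: quadratic_induct)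
  case (add f g)
  from quadratic_form_add_scaled[OF add(2,1), of 1] show ?case
    by (simp add: eval_add[abs_def])
qed (auto simp: quadratic_form_def linear_functional_def polar_def eval_zero eval_monom2
       algebra_simps power2_eq_square)

section \<open>Linear changes of coordinates\<close>

lemma change_coords_monom2:
  "change_coords A (monom2 c i j) =
     (\<Sum>k\<in>UNIV. \<Sum>l\<in>UNIV. monom2 (c * A $ i $ k * A $ j $ l) k l)"
proof -
  have *: "Const c * ((Const a * Indet k) * (Const b * Indet l)) = monom2 (c * a * b) k l"
    for a b k l
    by (simp add: Const_def Indet_def monom2_def mult_single ac_simps)
  show ?thesis
    unfolding change_coords_def subst_monom2[of Const, OF Const_zero] mult.assoc[of "Const c"]
    by (simp only: sum_product) (simp only: sum_distrib_left *)
qed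

lemma change_coords_add: "change_coords A (f + g) = change_coords A f + change_coords A g"
  by (simp add: change_coords_def subst_add Const_zero Const_add)

lemma change_coords_zero: "change_coords A 0 = 0"
  by (simp add: change_coords_def subst_zero)

lemma is_form_change_coords: "is_form 2 f \<Longrightarrow> is_form 2 (change_coords A f)"
  by (induction rule: quadratic_induct)
     (auto simp: change_coords_zero is_form_zero change_coords_monom2 change_coords_add
       intro!: is_form_sum is_form_monom2 is_form_add)

lemma eval_change_coords: "is_form 2 f \<Longrightarrow> eval (change_coords A f) v = eval f (A *v v)"
proof (induction rule: quadratic_induct)
  case (monom c i j)
  show ?case
    by (simp add: change_coords_monom2 eval_sum eval_monom2 matrix_vector_mult_def
        sum_distrib_left sum_distrib_right ac_simps)
qed (auto simp: change_coords_zero change_coords_add eval_zero eval_add)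

text \<open>Recovers the coefficients from the values on basis vectors and their sums, over any
  field. A quadratic form, as a polynomial, is therefore determined by its function even over small
  fields.\<close>

lemma lookup_quadratic:
  fixes f :: "('n::finite, 'a::field) mpoly"
  assumes "is_form 2 f"
  shows "Poly_Mapping.lookup f (Poly_Mapping.single i 1 + Poly_Mapping.single j 1) =
     (if i = j then eval f (axis i 1) else polar (eval f) (axis i 1) (axis j 1))"
  using assms
proof (induction rule: quadratic_induct)
  case (monom c k l)
  have "Poly_Mapping.single k (1::nat) + Poly_Mapping.single l 1 =
      Poly_Mapping.single i 1 + Poly_Mapping.single j 1 \<longleftrightarrow>
      (k = i \<and> l = j) \<or> (k = j \<and> l = i)" (is "?x = ?y \<longleftrightarrow> _")
  proof
    assume "?x = ?y"
    \<comment> \<open>Comparing exponents at \<open>i\<close>, \<open>j\<close> and \<open>k\<close>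
      determines the unordered pair of indices.\<close>
    then have "Poly_Mapping.lookup ?x r = Poly_Mapping.lookup ?y r" for r by simp
    from this[of i] this[of j] this[of k]
    show "(k = i \<and> l = j) \<or> (k = j \<and> l = i)"
      by (auto simp: lookup_add lookup_single when_def split: if_splits)
  qed (auto simp: add.commute)
  then have "Poly_Mapping.lookup (monom2 c k l) ?y =
      (if (k = i \<and> l = j) \<or> (k = j \<and> l = i) then c else 0)"
    by (simp only: monom2_def lookup_single when_def)
  then show ?case
    by (simp only:) (auto simp: polar_def eval_monom2 axis_def)
qed (auto simp: lookup_add eval_zero eval_add polar_def)

lemma quadratic_eq_zero_if_eval_zero:
  fixes f :: "('n::finite, 'a::field) mpoly"
  assumes f: "is_form 2 f" and "\<And>v. eval f v = 0"
  shows "f = 0"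
proof (rule ccontr)
  assume "f \<noteq> 0"
  then obtain m where m: "m \<in> Poly_Mapping.keys f" by (metis ex_in_conv keys_eq_empty)
  with f have "monom_degree m = 2" by (simp add: is_form_def)
  then obtain i j where "m = Poly_Mapping.single i 1 + Poly_Mapping.single j 1"
    by (rule monom_degree_2E)
  with m show False
    using lookup_quadratic[OF f, of i j] assms(2)
    by (simp add: in_keys_iff polar_def del: One_nat_def split: if_splits)
qed

section \<open>Rank and radical\<close>

lemma form_rank_le:
  fixes f :: "('n::finite, 'a::field) mpoly"
  assumes "invertible A" and "indets (change_coords A f) \<subseteq> I"
  shows "form_rank f \<le> card I"
proof -
  have "form_rank f \<le> card (indets (change_coords A f))"
    unfolding form_rank_def using assms(1) by (intro Least_le) blast
  also have "\<dots> \<le> card I" using assms(2) by (intro card_mono) auto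
  finally show ?thesis .
qed

lemma invertible_matrix_with_column:
  fixes v :: "'a::field ^ 'n::finite"
  assumes "v \<noteq> 0"
  obtains A :: "'a ^ 'n ^ 'n" and k where "invertible A" "A *v axis k 1 = v"
proof -
  from assms obtain k where k: "v $ k \<noteq> 0" by (auto simp: vec_eq_iff)
  define A :: "'a ^ 'n ^ 'n" where "A = (\<chi> i j. if j = k then v $ i else mat 1 $ i $ j)"
  \<comment> \<open>\<open>A\<close> is the identity with column \<open>k\<close> replaced by
    \<open>v\<close>; Cramer's rule for the identity matrix gives its determinant.\<close>
  have "det A = v $ k"
    using cramer_lemma[of k "mat 1" v] by (simp add: A_def cong: if_cong)
  with k have "invertible A" by (simp add: invertible_det_nz)
  moreover have "A *v axis k 1 = v"
    by (simp add: A_def matrix_vector_mult_def axis_def vec_eq_iff if_distrib cong: if_cong)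
  ultimately show thesis by (rule that)
qed

text \<open>Taking a singular vector of the radical as a basis vector removes an indeterminate.\<close>

lemma form_rank_radical:
  fixes f :: "('n::finite, 'a::field) mpoly"
  assumes f: "is_form 2 f" and p: "p \<noteq> 0" "eval f p = 0" "\<And>w. polar (eval f) p w = 0"
  shows "form_rank f < CARD('n)"
proof -
  obtain A :: "'a ^ 'n ^ 'n" and k where A: "invertible A" "A *v axis k 1 = p"
    using invertible_matrix_with_column[OF p(1)] by blast
  let ?h = "change_coords A f"
  have h: "is_form 2 ?h" by (rule is_form_change_coords[OF f])
  have "k \<notin> Poly_Mapping.keys m" if m: "m \<in> Poly_Mapping.keys ?h" for m
  proof
    assume k: "k \<in> Poly_Mapping.keys m"
    from h m have "monom_degree m = 2" by (simp add: is_form_def)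
    then obtain i j where ij: "m = Poly_Mapping.single i 1 + Poly_Mapping.single j 1"
      by (rule monom_degree_2E)
    with k have "i = k \<or> j = k"
      by (auto simp: in_keys_iff lookup_add lookup_single when_def split: if_splits)
    with ij obtain j where "m = Poly_Mapping.single k 1 + Poly_Mapping.single j 1"
      by (metis add.commute)
    \<comment> \<open>The \<open>k\<close>-th basis vector is sent to \<open>p\<close>, so these
      coefficients are \<open>eval f p\<close> or values of the polar form at
      \<open>p\<close>.\<close>
    moreover have "Poly_Mapping.lookup ?h (Poly_Mapping.single k 1 + Poly_Mapping.single j 1) = 0"
      using p(2,3) by (cases "j = k") (simp_all add: lookup_quadratic[OF h]
          eval_change_coords[OF f] A(2) polar_def matrix_vector_right_distrib del: One_nat_def)
    ultimately show False using m by (simp add: in_keys_iff)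
  qed
  then have "indets ?h \<subseteq> - {k}" by (auto simp: indets_def)
  then have "form_rank f \<le> card (- {k})" by (rule form_rank_le[OF A(1)])
  also have "\<dots> < CARD('n)" by (rule psubset_card_mono) auto
  finally show ?thesis .
qed

subsection \<open>Projective points\<close>

lemma proj_points_eq:
  "proj_points = {vec.span {v} | v :: 'a::field ^ 'n::finite. v \<noteq> 0}"
proof (intro equalityI subsetI; clarsimp simp: proj_points_def)
  fix P :: "('a ^ 'n) set"
  assume P: "vec.subspace P" "vec.dim P = Suc 0"
  obtain B where B: "B \<subseteq> P" "vec.independent B" "P \<subseteq> vec.span B" "card B = vec.dim P"
    by (rule vec.basis_exists)
  with P obtain v where v: "B = {v}" by (auto simp: card_1_singleton_iff)
  with B have "v \<noteq> 0" using vec.dependent_zero by blast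
  moreover have "P = vec.span {v}"
    using B v P by (metis subset_antisym vec.span_minimal)
  ultimately show "\<exists>v. P = vec.span {v} \<and> v \<noteq> 0" by blast
qed

text \<open>The nonzero vectors of \<open>S\<close> are partitioned by the projective points inside
  \<open>S\<close>, each contributing q - 1 of them.\<close>

lemma card_cone:
  fixes S :: "('a::{field,finite} ^ 'n::finite) set"
  assumes 0: "0 \<in> S" and S: "\<And>c v. v \<in> S \<Longrightarrow> c *s v \<in> S"
  shows "card S = 1 + (CARD('a) - 1) * card {P \<in> proj_points. P \<subseteq> S}"
proof -
  let ?X = "{P \<in> proj_points. P \<subseteq> S}"
  have "card (\<Union>P\<in>?X. P - {0}) = (\<Sum>P\<in>?X. card (P - {0}))"
  proof (intro card_UN_disjoint ballI impI)
    \<comment> \<open>Any nonzero vector of a point spans it, so distinct points meet only in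
      0.\<close>
    have span: "P = vec.span {w}" if "P \<in> ?X" "w \<in> P - {0}" for P w
    proof -
      obtain v where v: "P = vec.span {v}" using \<open>P \<in> ?X\<close> by (auto simp: proj_points_eq)
      with that(2) obtain c where c: "w = c *s v" "c \<noteq> 0" by (auto simp: vec.span_singleton)
      then have "v = (1 / c) *s w" by simp
      then have "v \<in> vec.span {w}" by (simp add: vec.span_scale vec.span_base)
      moreover have "w \<in> vec.span {v}" using that(2) v by simp
      ultimately show ?thesis unfolding v by (simp add: vec.span_eq)
    qed
    fix P Q assume "P \<in> ?X" "Q \<in> ?X" "P \<noteq> Q"
    show "(P - {0}) \<inter> (Q - {0}) = {}"
    proof (rule equals0I)
      fix w assume "w \<in> (P - {0}) \<inter> (Q - {0})"
      then have "P = vec.span {w}" "Q = vec.span {w}"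
        by (auto intro!: span[OF \<open>P \<in> ?X\<close>] span[OF \<open>Q \<in> ?X\<close>])
      with \<open>P \<noteq> Q\<close> show False by simp
    qed
  qed auto
  also have "\<dots> = (\<Sum>P\<in>?X. CARD('a) - 1)"
  proof (rule sum.cong)
    fix P assume "P \<in> ?X"
    then obtain v where v: "P = vec.span {v}" "v \<noteq> 0" by (auto simp: proj_points_eq)
    then have "bij_betw (\<lambda>c. c *s v) (UNIV - {0}) (P - {0})"
      by (auto simp: bij_betw_def inj_on_def vec.span_singleton)
    then show "card (P - {0}) = CARD('a) - 1"
      using bij_betw_same_card by fastforce
  qed simp
  also have "(\<Union>P\<in>?X. P - {0}) = S - {0}"
  proof (intro equalityI subsetI)
    fix v assume v: "v \<in> S - {0}"
    then have "vec.span {v} \<in> ?X" using S by (auto simp: proj_points_eq vec.span_singleton)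
    moreover have "v \<in> vec.span {v}" by (simp add: vec.span_base)
    ultimately show "v \<in> (\<Union>P\<in>?X. P - {0})" using v by blast
  qed auto
  finally have "card (S - {0}) = (CARD('a) - 1) * card ?X" by simp
  with 0 show ?thesis by (metis card.remove finite plus_1_eq_Suc)
qed

section \<open>Intersection of an elliptic quadric with another quadric\<close>

theorem proposition6p6:
  fixes f g :: "(4, 'a::{field,finite}) mpoly" and q :: nat
  assumes "q = CARD('a)" and "q \<ge> 3"
    and "elliptic_quadric f"
    and "quadric g"
    and "\<not> proportional f g"
  shows "card (zero_set f \<inter> zero_set g) = 2 * (q + 1) \<or>
         card (zero_set f \<inter> zero_set g) = 2 * q + 1 \<or>
         card (zero_set f \<inter> zero_set g) \<le> 2 * q"
proof -
  let ?F = "eval f" and ?G = "eval g" and ?b = "card (zero_set f \<inter> zero_set g)"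
  have f: "is_form 2 f" and g: "is_form 2 g" "g \<noteq> 0"
    and rank: "form_rank f = 4" and card_f: "card (zero_set f) = q\<^sup>2 + 1"
    using assms by (auto simp: elliptic_quadric_def quadric_def nondegenerate_def)
  note F = quadratic_form_eval[OF f] and G = quadratic_form_eval[OF g(1)]
  obtain r where r: "q = r + 1" using assms(2) by (cases q) auto
  have nondeg: "\<exists>w. polar ?F p w \<noteq> 0" if "p \<noteq> 0" "?F p = 0" for p
    using form_rank_radical[OF f that] rank by auto
  \<comment> \<open>A member vanishing identically would be the zero polynomial, making
    \<open>g\<close> a multiple of \<open>f\<close>; the factor is nonzero because \<open>g\<close>
    is.\<close>
  have indep: "\<exists>v. ?G v + c * ?F v \<noteq> 0" for c
  proof (rule ccontr)
    assume "\<not> ?thesis"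
    then have "g + Const c * f = 0"
      by (intro quadratic_eq_zero_if_eval_zero is_form_add is_form_Const_mult f g)
         (simp add: eval_add eval_Const_mult f)
    then have eq: "g = Const (- c) * f"
      by (simp add: Const_def single_uminus add_eq_0_iff2)
    with g(2) have "c \<noteq> 0" by (auto simp: Const_zero)
    with eq have "proportional f g" unfolding proportional_def by (intro exI[of _ "- c"]) simp
    with assms(5) show False by simp
  qed
  have "card {v. ?F v = 0} = 1 + (CARD('a) - 1) * card {P \<in> proj_points. P \<subseteq> {v. ?F v = 0}}"
    by (rule card_cone) (auto simp: quadratic_form_zero quadratic_form_scale F)
  also have "{P \<in> proj_points. P \<subseteq> {v. ?F v = 0}} = zero_set f"
    by (auto simp: zero_set_def)
  finally have "card {v. ?F v = 0} + CARD('a)\<^sup>2 = CARD('a) ^ 3 + CARD('a)"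
    using card_f r unfolding assms(1)[symmetric]
    by (simp add: algebra_simps power2_eq_square power3_eq_cube)
  from card_common_zeros[OF F nondeg this G indep]
  have le: "card {w. ?F w = 0 \<and> ?G w = 0} + 1 \<le> 2 * q\<^sup>2" by (simp add: assms(1))
  have "card {v. ?F v = 0 \<and> ?G v = 0} =
      1 + (CARD('a) - 1) * card {P \<in> proj_points. P \<subseteq> {v. ?F v = 0 \<and> ?G v = 0}}"
    by (rule card_cone) (auto simp: quadratic_form_zero quadratic_form_scale F G)
  also have "{P \<in> proj_points. P \<subseteq> {v. ?F v = 0 \<and> ?G v = 0}} = zero_set f \<inter> zero_set g"
    by (auto simp: zero_set_def)
  finally have "card {v. ?F v = 0 \<and> ?G v = 0} = 1 + r * ?b"
    using r by (simp flip: assms(1))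
  \<comment> \<open>From 2 + r b \<le> 2q^2 with r = q - 1, using q^2 - 1 = r (q + 1); the positive
    factor \<open>r\<close> then cancels.\<close>
  with le have "r * ?b \<le> r * (2 * (q + 1))"
    by (simp add: r algebra_simps power2_eq_square)
  with r assms(2) have "?b \<le> 2 * (q + 1)"
    by (simp only: mult_le_cancel1)
  \<comment> \<open>For a natural number, being at most 2q + 2 is exactly the three-way
    alternative.\<close>
  then show ?thesis by arith
qed

end
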